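(* Let $\mathcal{C}$ be the class of all finite simple graphs $G$ such that $\alpha(H) \geq |V(H)|/3$ for every induced subgraph $H$ of $G$. Then every graph $G$ in $\mathcal{C}$ satisfies $\theta(G) \le \left\lfloor \frac{8}{5}\alpha(G) \right\rfloor$. This is best possible, in the sense that for every integer $x\geq 0$ there exists a graph $G$ in $\mathcal{C}$ with $\alpha(G) = x$ and $\theta(G) = \left\lfloor \frac{8}{5}\alpha(G) \right\rfloor$.
   Context: All graphs are finite and simple; the graph with no vertices is allowed. For a graph $G$, $\alpha(G)$ is the maximum size of a stable (independent) set of $G$, and $\theta(G)$ is the minimum number of cliques needed to cover the vertices of $G$ (equivalently, the chromatic number of the complement of $G$); for the graph with no vertices both equal $0$. *)

theory Defs
  imports Complex_Main "Graph_Theory.Graph_Theory"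
begin

text \<open>
  A finite simple graph is a graph \<open>G\<close> with \<open>pair_graph G\<close>: a finite vertex set
  together with a symmetric, loopless set of ordered pairs, an edge \<open>uv\<close> being
  represented by the two pairs \<open>(u, v)\<close> and \<open>(v, u)\<close>. The vertex set may be empty.
\<close>

definition stable_set :: "'a pair_pre_digraph \<Rightarrow> 'a set \<Rightarrow> bool" where
  "stable_set G S \<longleftrightarrow> S \<subseteq> pverts G \<and> (\<forall>u\<in>S. \<forall>v\<in>S. (u, v) \<notin> parcs G)"

definition clique :: "'a pair_pre_digraph \<Rightarrow> 'a set \<Rightarrow> bool" where
  "clique G K \<longleftrightarrow> K \<subseteq> pverts G \<and> (\<forall>u\<in>K. \<forall>v\<in>K. u \<noteq> v \<longrightarrow> (u, v) \<in> parcs G)"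

definition clique_cover :: "'a pair_pre_digraph \<Rightarrow> 'a set set \<Rightarrow> bool" where
  "clique_cover G \<K> \<longleftrightarrow> (\<forall>K\<in>\<K>. clique G K) \<and> \<Union>\<K> = pverts G"

text \<open>
  For finite \<open>G\<close> the sets below are finite and nonempty (witnessed by the empty
  stable set and the cover by singletons), so \<open>Max\<close> and \<open>Min\<close> are attained.
  Both numbers are 0 for the graph without vertices.
\<close>

definition stability_number :: "'a pair_pre_digraph \<Rightarrow> nat" where
  "stability_number G = Max {card S |S. stable_set G S}"

definition clique_cover_number :: "'a pair_pre_digraph \<Rightarrow> nat" where
  "clique_cover_number G = Min {card \<K> |\<K>. clique_cover G \<K>}"

definition third_stable_class :: "'a pair_pre_digraph set" where
  "third_stable_class =
    {G. pair_graph G \<and>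
        (\<forall>H :: 'a pair_pre_digraph. induced_subgraph (with_proj H) (with_proj G) \<longrightarrow>
           real (stability_number H) \<ge> real (card (pverts H)) / 3)}"

end

theory Submission
  imports Defs
begin

text \<open>
  Write \<open>\<theta>\<close> and \<open>\<alpha>\<close> for the clique cover number and the stability number of the subgraph induced
  by a vertex set.

  \<^bold>\<open>Upper bound.\<close> Since \<open>5 \<theta> \<le> 8 \<alpha>\<close> survives disjoint unions and the passage to a larger graph with
  the same \<open>\<theta>\<close>, a minimal counterexample is connected and critical: deleting any vertex lowers \<open>\<theta>\<close>.
  Gallai's theorem (\<open>gallai\<close>), read in the complement, says that such a graph on \<open>n\<close> vertices
  satisfies \<open>2 \<theta> \<le> n + 1\<close>, so that \<open>2 \<theta> \<le> 3 \<alpha> + 1\<close> by the hypothesis on the graph itself.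
  Rounding this to integers gives \<open>5 \<theta> \<le> 8 \<alpha>\<close> for every \<open>\<alpha>\<close> except \<open>\<alpha> = 3\<close>, where it leaves the
  single possibility \<open>\<theta> = 5\<close>, \<open>n = 9\<close>. That case is excluded by Ramsey arguments (\<open>theta_nine\<close>): a graph
  with nine vertices, none of them isolated, and \<open>\<alpha> \<le> 3\<close> has \<open>\<theta> \<le> 4\<close>.

  Gallai's theorem is proved by induction, with Hall's theorem as the only tool. If \<open>B\<close> is a largest
  nonempty set with \<open>\<theta>(V - B) = \<theta>(V) - 1\<close>, then the components of \<open>V - B\<close> are again critical, and by
  induction a failure of the claim makes them at least as numerous as the vertices of \<open>B\<close>. A
  critical component absorbs any one of its neighbours in \<open>B\<close> without raising \<open>\<theta>\<close>; a matching of
  \<open>B\<close> into the components, or of a suitable part of \<open>B\<close>, thus extends a cover with fewer than \<open>\<theta>(V)\<close>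
  cliques to all of \<open>V\<close>.

  \<^bold>\<open>Sharpness.\<close> A triangle-free graph has \<open>\<theta> \<ge> n / 2\<close>, and a 3-colourable one has \<open>\<alpha>(H) \<ge> |V(H)| / 3\<close> for
  all its induced subgraphs \<open>H\<close>. The graph on \<open>{0, \<dots>, 14}\<close> that joins two numbers at distance 1, 5 or 8 is
  triangle-free, properly coloured by the residue mod 3, and has \<open>\<alpha> = 5\<close>, hence \<open>\<theta> \<ge> 8\<close>. Disjoint copies of
  it, together with an induced subgraph of one more copy, attain the bound for every value of \<open>\<alpha>\<close>.
\<close>

section \<open>Hall's theorem\<close>

text \<open>
  Halmos and Vaughan's induction: if some proper nonempty \<open>J\<close> is tight, match \<open>J\<close> inside its
  neighbourhood and the rest outside it; if none is, any single assignment leaves the condition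
  intact.
\<close>

theorem hall:
  fixes A :: "'i \<Rightarrow> 'b set"
  assumes "finite I" "\<And>i. i \<in> I \<Longrightarrow> finite (A i)"
    and "\<And>J. J \<subseteq> I \<Longrightarrow> card J \<le> card (\<Union>(A ` J))"
  shows "\<exists>f. inj_on f I \<and> (\<forall>i\<in>I. f i \<in> A i)"
  using assms
proof (induction "card I" arbitrary: I A rule: less_induct)
  case (less I A)
  note fin = less.prems(1,2) and cond = less.prems(3)
  have finU: "finite (\<Union>(A ` J))" if "J \<subseteq> I" for J
    using that fin finite_subset[OF that fin(1)] by blast
  show ?case
  proof (cases "I = {}")
    case False
    show ?thesis
    proof (cases "\<exists>J. J \<noteq> {} \<and> J \<subset> I \<and> card (\<Union>(A ` J)) = card J")
      case True
      then obtain J where J: "J \<noteq> {}" "J \<subset> I" "card (\<Union>(A ` J)) = card J" by blast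
      have finJ: "finite J" using J(2) fin(1) finite_subset by blast
      have "card J < card I" using J(2) fin(1) by (simp add: psubset_card_mono)
      moreover have "\<And>i. i \<in> J \<Longrightarrow> finite (A i)" using fin J(2) by blast
      moreover have "\<And>L. L \<subseteq> J \<Longrightarrow> card L \<le> card (\<Union>(A ` L))" using cond J(2) by blast
      ultimately obtain f where f: "inj_on f J" "\<forall>i\<in>J. f i \<in> A i"
        using less.hyps[of J A] finJ by blast
      define A' where "A' = (\<lambda>i. A i - \<Union>(A ` J))"
      have "card (I - J) < card I" using J(1,2) fin(1) by (intro psubset_card_mono) auto
      moreover have "\<And>i. i \<in> I - J \<Longrightarrow> finite (A' i)" using fin by (simp add: A'_def)
      moreover have "card L \<le> card (\<Union>(A' ` L))" if L: "L \<subseteq> I - J" for L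
      proof -
        have finL: "finite L" using L fin(1) finite_subset by blast
        have "card L + card J = card (L \<union> J)"
          using L finL finJ by (subst card_Un_disjoint) auto
        also have "\<dots> \<le> card (\<Union>(A ` (L \<union> J)))" using cond L J(2) by (meson Diff_subset Un_least psubset_imp_subset subset_trans)
        also have "\<Union>(A ` (L \<union> J)) = \<Union>(A' ` L) \<union> \<Union>(A ` J)" by (auto simp: A'_def)
        also have "card \<dots> \<le> card (\<Union>(A' ` L)) + card (\<Union>(A ` J))" by (rule card_Un_le)
        finally show ?thesis using J(3) by simp
      qed
      ultimately obtain g where g: "inj_on g (I - J)" "\<forall>i\<in>I-J. g i \<in> A' i"
        using less.hyps[of "I - J" A'] fin(1) by blast
      define h where "h = (\<lambda>i. if i \<in> J then f i else g i)"
      have "inj_on h I"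
        unfolding inj_on_def
      proof (intro ballI impI)
        fix x y assume xy: "x \<in> I" "y \<in> I" "h x = h y"
        have neq: "f a \<noteq> g b" if "a \<in> J" "b \<in> I - J" for a b
          using f(2) g(2) that by (auto simp: A'_def)
        show "x = y"
          using xy f(1) g(1) neq[of x y] neq[of y x]
          by (cases "x \<in> J"; cases "y \<in> J") (auto simp: h_def inj_on_def)
      qed
      moreover have "\<forall>i\<in>I. h i \<in> A i" using f(2) g(2) by (auto simp: h_def A'_def)
      ultimately show ?thesis by blast
    next
      case noncrit: False
      obtain i where i: "i \<in> I" using False by blast
      have "card {i} \<le> card (\<Union>(A ` {i}))" using cond i by blast
      then obtain x where x: "x \<in> A i" by fastforce
      define A' where "A' = (\<lambda>j. A j - {x})"
      have "card (I - {i}) < card I" using i fin(1) by (intro psubset_card_mono) auto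
      moreover have "\<And>j. j \<in> I - {i} \<Longrightarrow> finite (A' j)" using fin by (simp add: A'_def)
      moreover have "card L \<le> card (\<Union>(A' ` L))" if L: "L \<subseteq> I - {i}" for L
      proof (cases "L = {}")
        case False
        have LI: "L \<subset> I" using L i by blast
        have "card L < card (\<Union>(A ` L))"
          using cond[of L] noncrit False LI by (metis le_neq_implies_less psubset_imp_subset)
        moreover have "\<Union>(A' ` L) = \<Union>(A ` L) - {x}" by (auto simp: A'_def)
        moreover have "finite (\<Union>(A ` L))" using finU LI by blast
        ultimately show ?thesis using card_Diff1_le[of "\<Union>(A ` L)" x]
          by (simp add: card_Diff_singleton_if Suc_leI) linarith
      qed simp
      ultimately obtain g where g: "inj_on g (I - {i})" "\<forall>j\<in>I-{i}. g j \<in> A' j"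
        using less.hyps[of "I - {i}" A'] fin(1) by blast
      define h where "h = g(i := x)"
      have "inj_on h I"
        using g by (auto simp: inj_on_def h_def A'_def)
      moreover have "\<forall>j\<in>I. h j \<in> A j" using g(2) x by (auto simp: h_def A'_def)
      ultimately show ?thesis by blast
    qed
  qed simp
qed

text \<open>
  For a largest set \<open>J\<close> that violates Hall's condition (or is empty), the remaining indices satisfy
  the condition with the values in \<open>\<Union>(A ` J)\<close> deleted, since otherwise a violation there could be
  added to \<open>J\<close>.
\<close>

corollary hall_deficient:
  fixes A :: "'i \<Rightarrow> 'b set"
  assumes fin: "finite I" "\<And>i. i \<in> I \<Longrightarrow> finite (A i)"
  obtains J f where "J \<subseteq> I" "J = {} \<or> card (\<Union>(A ` J)) < card J"
    "inj_on f (I - J)" "\<And>i. i \<in> I - J \<Longrightarrow> f i \<in> A i - \<Union>(A ` J)"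
proof -
  define P where "P = (\<lambda>J. J \<subseteq> I \<and> (J = {} \<or> card (\<Union>(A ` J)) < card J))"
  have "P {}" by (simp add: P_def)
  moreover have "\<forall>J. P J \<longrightarrow> card J \<le> card I"
    using fin(1) by (auto simp: P_def card_mono)
  ultimately obtain J where J: "P J" and Jmax: "\<And>L. P L \<Longrightarrow> card L \<le> card J"
    using ex_has_greatest_nat[of P "{}" card "card I"] by (metis less_imp_le le_less_trans lessI not_less)
  have finJ: "finite J" using J fin(1) finite_subset by (auto simp: P_def)
  have "\<exists>f. inj_on f (I - J) \<and> (\<forall>i\<in>I-J. f i \<in> A i - \<Union>(A ` J))"
  proof (rule hall)
    fix L assume L: "L \<subseteq> I - J"
    have finL: "finite L" using L fin(1) finite_subset by blast
    show "card L \<le> card (\<Union>((\<lambda>i. A i - \<Union>(A ` J)) ` L))"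
    proof (rule ccontr)
      assume a: "\<not> ?thesis"
      then have Lne: "L \<noteq> {}" by auto
      have "\<Union>(A ` (L \<union> J)) = \<Union>((\<lambda>i. A i - \<Union>(A ` J)) ` L) \<union> \<Union>(A ` J)" by auto
      then have "card (\<Union>(A ` (L \<union> J))) \<le> card (\<Union>((\<lambda>i. A i - \<Union>(A ` J)) ` L)) + card (\<Union>(A ` J))"
        by (metis card_Un_le)
      moreover have "card (\<Union>(A ` J)) \<le> card J" using J by (auto simp: P_def)
      moreover have c: "card (L \<union> J) = card L + card J"
        using L finL finJ by (subst card_Un_disjoint) auto
      ultimately have "card (\<Union>(A ` (L \<union> J))) < card (L \<union> J)" using a by linarith
      then have "P (L \<union> J)" using L J by (auto simp: P_def)
      then show False using Jmax c Lne finL by (metis Nat.add_0 add_le_cancel_right card_0_eq le_zero_eq)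
    qed
  qed (use fin in auto)
  then show thesis using that J by (auto simp: P_def)
qed

section \<open>Clique covers and stable sets of vertex sets\<close>

locale adjacency =
  fixes adj :: "'a \<Rightarrow> 'a \<Rightarrow> bool" (infix \<open>\<sim>\<close> 50)
  assumes adj_sym: "u \<sim> v \<Longrightarrow> v \<sim> u" and adj_irrefl: "\<not> u \<sim> u"
begin

definition is_clique :: "'a set \<Rightarrow> bool" where
  "is_clique K \<longleftrightarrow> (\<forall>u\<in>K. \<forall>v\<in>K. u \<noteq> v \<longrightarrow> u \<sim> v)"

definition is_indep :: "'a set \<Rightarrow> bool" where
  "is_indep S \<longleftrightarrow> (\<forall>u\<in>S. \<forall>v\<in>S. \<not> u \<sim> v)"

definition anticomplete :: "'a set \<Rightarrow> 'a set \<Rightarrow> bool" where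
  "anticomplete X Y \<longleftrightarrow> X \<inter> Y = {} \<and> (\<forall>x\<in>X. \<forall>y\<in>Y. \<not> x \<sim> y)"

text \<open>
  The cliques may leave \<open>X\<close>. This makes coverability monotone in \<open>X\<close>, and it changes no minimum
  because subsets of cliques are cliques.
\<close>

definition coverable :: "'a set \<Rightarrow> nat \<Rightarrow> bool" where
  "coverable X k \<longleftrightarrow> (\<exists>\<K>. finite \<K> \<and> card \<K> \<le> k \<and> (\<forall>K\<in>\<K>. is_clique K) \<and> X \<subseteq> \<Union>\<K>)"

definition theta :: "'a set \<Rightarrow> nat" where
  "theta X = (LEAST k. coverable X k)"

definition alpha :: "'a set \<Rightarrow> nat" where
  "alpha X = Max (card ` {S. S \<subseteq> X \<and> is_indep S})"

lemma is_clique_subset: "is_clique K \<Longrightarrow> L \<subseteq> K \<Longrightarrow> is_clique L"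
  by (auto simp: is_clique_def)

lemma is_clique_simps [simp]:
  "is_clique {}" "is_clique {u}" "is_clique {u, v} \<longleftrightarrow> u = v \<or> u \<sim> v"
  using adj_sym by (auto simp: is_clique_def)

lemma is_clique_insert: "is_clique K \<Longrightarrow> (\<And>v. v \<in> K \<Longrightarrow> u \<sim> v) \<Longrightarrow> is_clique (insert u K)"
  unfolding is_clique_def by (metis adj_sym insert_iff)

lemma is_indep_subset: "is_indep S \<Longrightarrow> T \<subseteq> S \<Longrightarrow> is_indep T"
  by (auto simp: is_indep_def)

lemma is_indep_insert: "is_indep S \<Longrightarrow> (\<And>v. v \<in> S \<Longrightarrow> \<not> u \<sim> v) \<Longrightarrow> is_indep (insert u S)"
  unfolding is_indep_def by (metis adj_sym adj_irrefl insert_iff)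

lemma is_indep_simps [simp]:
  "is_indep {}" "is_indep {u}" "is_indep {u, v} \<longleftrightarrow> \<not> u \<sim> v"
  using adj_sym adj_irrefl by (auto simp: is_indep_def)

lemma anticomplete_sym: "anticomplete X Y \<Longrightarrow> anticomplete Y X"
  using adj_sym unfolding anticomplete_def by blast

lemma anticomplete_subset:
  "anticomplete X Y \<Longrightarrow> X' \<subseteq> X \<Longrightarrow> Y' \<subseteq> Y \<Longrightarrow> anticomplete X' Y'"
  unfolding anticomplete_def by blast

lemma theta_le: "coverable X k \<Longrightarrow> theta X \<le> k"
  unfolding theta_def by (rule Least_le)

lemma coverable_theta:
  assumes "finite X"
  shows "coverable X (theta X)"
proof -
  have "coverable X (card X)"
    unfolding coverable_def
    by (rule exI[of _ "(\<lambda>x. {x}) ` X"]) (use assms in \<open>auto simp: card_image_le\<close>)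
  then show ?thesis unfolding theta_def by (rule LeastI)
qed

lemma coverable_mono: "coverable Y k \<Longrightarrow> X \<subseteq> Y \<Longrightarrow> k \<le> l \<Longrightarrow> coverable X l"
  unfolding coverable_def by (metis le_trans subset_trans)

lemma coverable_Un:
  assumes "coverable X k" "coverable Y l"
  shows "coverable (X \<union> Y) (k + l)"
proof -
  obtain \<K> \<L> where "finite \<K>" "card \<K> \<le> k" "\<forall>K\<in>\<K>. is_clique K" "X \<subseteq> \<Union>\<K>"
    "finite \<L>" "card \<L> \<le> l" "\<forall>K\<in>\<L>. is_clique K" "Y \<subseteq> \<Union>\<L>"
    using assms unfolding coverable_def by blast
  moreover from this have "card (\<K> \<union> \<L>) \<le> k + l"
    using card_Un_le[of \<K> \<L>] by linarith
  ultimately show ?thesis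
    unfolding coverable_def by (intro exI[of _ "\<K> \<union> \<L>"]) auto
qed

lemma theta_mono: "finite Y \<Longrightarrow> X \<subseteq> Y \<Longrightarrow> theta X \<le> theta Y"
  by (rule theta_le, rule coverable_mono[OF coverable_theta[of Y]]) auto

lemma theta_Un: "finite X \<Longrightarrow> finite Y \<Longrightarrow> theta (X \<union> Y) \<le> theta X + theta Y"
  by (rule theta_le, rule coverable_Un[OF coverable_theta coverable_theta])

lemma theta_clique: "is_clique K \<Longrightarrow> theta K \<le> 1"
  by (rule theta_le, unfold coverable_def, rule exI[of _ "{K}"]) simp

lemma theta_empty [simp]: "theta {} = 0"
proof -
  have "coverable {} 0" unfolding coverable_def by (rule exI[of _ "{}"]) simp
  then show ?thesis using theta_le by fastforce
qed

lemma theta_UN_le: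
  assumes "finite \<X>" "\<And>X. X \<in> \<X> \<Longrightarrow> finite (g X)"
  shows "theta (\<Union>(g ` \<X>)) \<le> (\<Sum>X\<in>\<X>. theta (g X))"
  using assms
proof (induction rule: finite_induct)
  case (insert X \<X>)
  have "theta (\<Union>(g ` insert X \<X>)) \<le> theta (g X) + theta (\<Union>(g ` \<X>))"
    using theta_Un[of "g X" "\<Union>(g ` \<X>)"] insert by simp
  then show ?case using insert by auto
qed simp

lemma theta_le_card:
  assumes "finite X"
  shows "theta X \<le> card X"
proof -
  have "theta (\<Union>((\<lambda>x. {x}) ` X)) \<le> (\<Sum>x\<in>X. theta {x})"
    using assms by (rule theta_UN_le) simp
  also have "\<dots> \<le> (\<Sum>x\<in>X. 1)" by (intro sum_mono theta_clique) simp
  finally show ?thesis by simp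
qed

lemma theta_Diff_clique:
  assumes "finite X" "is_clique K"
  shows "theta X \<le> theta (X - K) + 1"
proof -
  have "X = (X - K) \<union> (X \<inter> K)" by blast
  then have "theta X \<le> theta (X - K) + theta (X \<inter> K)"
    using assms(1) theta_Un[of "X - K" "X \<inter> K"] by auto
  moreover have "theta (X \<inter> K) \<le> 1"
    using assms(2) is_clique_subset theta_clique by blast
  ultimately show ?thesis by linarith
qed

text \<open>
  No clique meets both of two sets without edges between them, so a cover of the union splits into
  covers of the parts.
\<close>

lemma theta_anticomplete:
  assumes fin: "finite X" "finite Y" and ac: "anticomplete X Y"
  shows "theta (X \<union> Y) = theta X + theta Y"
proof (rule antisym)
  obtain \<K> where K: "finite \<K>" "card \<K> \<le> theta (X \<union> Y)" "\<forall>K\<in>\<K>. is_clique K" "X \<union> Y \<subseteq> \<Union>\<K>"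
    using coverable_theta[of "X \<union> Y"] fin unfolding coverable_def by blast
  define \<A> \<B> where "\<A> = {K \<in> \<K>. K \<inter> X \<noteq> {}}" and "\<B> = {K \<in> \<K>. K \<inter> Y \<noteq> {}}"
  have "K \<inter> Y = {}" if KA: "K \<in> \<A>" for K
  proof (rule ccontr)
    assume "K \<inter> Y \<noteq> {}"
    then obtain x y where "x \<in> K" "x \<in> X" "y \<in> K" "y \<in> Y" "is_clique K"
      using KA K(3) unfolding \<A>_def by blast
    then show False using ac unfolding anticomplete_def is_clique_def by (metis disjoint_iff)
  qed
  then have disj: "\<A> \<inter> \<B> = {}" by (auto simp: \<B>_def)
  have "X \<subseteq> \<Union>\<A>" "Y \<subseteq> \<Union>\<B>" using K(4) unfolding \<A>_def \<B>_def by blast+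
  moreover have "finite \<A>" "finite \<B>" "\<forall>K\<in>\<A>. is_clique K" "\<forall>K\<in>\<B>. is_clique K"
    using K(1,3) by (auto simp: \<A>_def \<B>_def)
  ultimately have "coverable X (card \<A>)" "coverable Y (card \<B>)"
    unfolding coverable_def by blast+
  then have "theta X + theta Y \<le> card \<A> + card \<B>" using theta_le add_mono by blast
  also have "\<dots> = card (\<A> \<union> \<B>)"
    using K(1) disj by (subst card_Un_disjoint) (auto simp: \<A>_def \<B>_def)
  also have "\<dots> \<le> card \<K>" using K(1) by (intro card_mono) (auto simp: \<A>_def \<B>_def)
  finally show "theta X + theta Y \<le> theta (X \<union> Y)" using K(2) by linarith
qed (rule theta_Un[OF fin])

lemma theta_Union_anticomplete:
  assumes "finite \<X>" "\<And>X. X \<in> \<X> \<Longrightarrow> finite X"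
    and "\<And>X Y. X \<in> \<X> \<Longrightarrow> Y \<in> \<X> \<Longrightarrow> X \<noteq> Y \<Longrightarrow> anticomplete X Y"
  shows "theta (\<Union>\<X>) = (\<Sum>X\<in>\<X>. theta X)"
  using assms
proof (induction rule: finite_induct)
  case (insert X \<X>)
  have "anticomplete X (\<Union>\<X>)"
    using insert.prems(2) insert.hyps(2) unfolding anticomplete_def by blast
  then have "theta (X \<union> \<Union>\<X>) = theta X + theta (\<Union>\<X>)"
    using insert by (intro theta_anticomplete) auto
  then show ?case using insert by simp
qed simp

lemma finite_indeps: "finite X \<Longrightarrow> finite {S. S \<subseteq> X \<and> is_indep S}"
  by (rule finite_subset[of _ "Pow X"]) auto

lemma alpha_le_iff:
  assumes "finite X"
  shows "alpha X \<le> k \<longleftrightarrow> (\<forall>S. S \<subseteq> X \<longrightarrow> is_indep S \<longrightarrow> card S \<le> k)"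
proof -
  have "card ` {S. S \<subseteq> X \<and> is_indep S} \<noteq> {}" using is_indep_simps(1) by blast
  then show ?thesis unfolding alpha_def using finite_indeps[OF assms] by (subst Max_le_iff) auto
qed

lemma card_le_alpha: "finite X \<Longrightarrow> S \<subseteq> X \<Longrightarrow> is_indep S \<Longrightarrow> card S \<le> alpha X"
  using alpha_le_iff[of X "alpha X"] by simp

lemma alpha_attained:
  assumes "finite X"
  obtains S where "S \<subseteq> X" "is_indep S" "card S = alpha X"
proof -
  have "card ` {S. S \<subseteq> X \<and> is_indep S} \<noteq> {}" using is_indep_simps(1) by blast
  then have "alpha X \<in> card ` {S. S \<subseteq> X \<and> is_indep S}"
    unfolding alpha_def using finite_indeps[OF assms] by (intro Max_in) auto
  then show thesis using that by auto
qed

lemma alpha_mono: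
  assumes "finite Y" "X \<subseteq> Y"
  shows "alpha X \<le> alpha Y"
proof -
  have "finite X" using assms finite_subset by blast
  then obtain S where "S \<subseteq> X" "is_indep S" "card S = alpha X" by (rule alpha_attained)
  then show ?thesis using card_le_alpha[of Y S] assms by auto
qed

lemma alpha_Un:
  assumes "finite X" "finite Y"
  shows "alpha (X \<union> Y) \<le> alpha X + alpha Y"
proof -
  obtain S where S: "S \<subseteq> X \<union> Y" "is_indep S" "card S = alpha (X \<union> Y)"
    using alpha_attained[of "X \<union> Y"] assms by blast
  have "S = (S \<inter> X) \<union> (S \<inter> Y)" using S(1) by blast
  then have "card S \<le> card (S \<inter> X) + card (S \<inter> Y)" by (metis card_Un_le)
  also have "\<dots> \<le> alpha X + alpha Y"
    using S(2) assms by (intro add_mono card_le_alpha) (auto intro: is_indep_subset)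
  finally show ?thesis using S(3) by simp
qed

lemma alpha_anticomplete:
  assumes fin: "finite X" "finite Y" and ac: "anticomplete X Y"
  shows "alpha X + alpha Y \<le> alpha (X \<union> Y)"
proof -
  obtain S T where S: "S \<subseteq> X" "is_indep S" "card S = alpha X"
    and T: "T \<subseteq> Y" "is_indep T" "card T = alpha Y"
    using alpha_attained fin by metis
  have "is_indep (S \<union> T)"
    using S T ac adj_sym unfolding is_indep_def anticomplete_def by blast
  moreover have "card (S \<union> T) = card S + card T"
    using S(1) T(1) ac fin by (intro card_Un_disjoint) (auto simp: anticomplete_def dest: finite_subset)
  ultimately show ?thesis
    using card_le_alpha[of "X \<union> Y" "S \<union> T"] S T fin by auto
qed

end

section \<open>Gallai's theorem on critical graphs\<close>

context adjacency
begin

definition is_connected :: "'a set \<Rightarrow> bool" where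
  "is_connected X \<longleftrightarrow> (\<forall>A B. X = A \<union> B \<longrightarrow> anticomplete A B \<longrightarrow> A = {} \<or> B = {})"

definition is_critical :: "'a set \<Rightarrow> bool" where
  "is_critical X \<longleftrightarrow> (\<forall>x\<in>X. theta (X - {x}) < theta X)"

lemma anticomplete_Union:
  "(\<And>X Y. X \<in> \<A> \<Longrightarrow> Y \<in> \<B> \<Longrightarrow> anticomplete X Y) \<Longrightarrow> anticomplete (\<Union>\<A>) (\<Union>\<B>)"
  unfolding anticomplete_def disjoint_iff by (metis Union_iff)

lemma anticomplete_Un_left:
  "anticomplete X Z \<Longrightarrow> anticomplete Y Z \<Longrightarrow> anticomplete (X \<union> Y) Z"
  unfolding anticomplete_def by auto

text \<open>
  Components are obtained by splitting repeatedly, so that connectedness needs no paths: a set is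
  connected if it is not the union of two nonempty sets without edges between them.
\<close>

lemma components_exist:
  assumes "finite Z"
  shows "\<exists>\<X>. \<Union>\<X> = Z \<and> (\<forall>X\<in>\<X>. X \<noteq> {} \<and> is_connected X) \<and>
    (\<forall>X\<in>\<X>. \<forall>Y\<in>\<X>. X \<noteq> Y \<longrightarrow> anticomplete X Y)"
  using assms
proof (induction "card Z" arbitrary: Z rule: less_induct)
  case (less Z)
  show ?case
  proof (cases "is_connected Z")
    case True
    then show ?thesis
      by (intro exI[of _ "if Z = {} then {} else {Z}"]) auto
  next
    case False
    then obtain A B where AB: "Z = A \<union> B" "anticomplete A B" "A \<noteq> {}" "B \<noteq> {}"
      unfolding is_connected_def by blast
    have "A \<inter> B = {}" using AB(2) by (simp add: anticomplete_def)
    then have "A \<subset> Z" "B \<subset> Z" using AB(1,3,4) by blast+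
    then have "card A < card Z" "card B < card Z" "finite A" "finite B"
      using less.prems by (auto intro: psubset_card_mono finite_subset)
    then obtain \<A> \<B> where A: "\<Union>\<A> = A" "\<forall>X\<in>\<A>. X \<noteq> {} \<and> is_connected X"
        "\<forall>X\<in>\<A>. \<forall>Y\<in>\<A>. X \<noteq> Y \<longrightarrow> anticomplete X Y"
      and B: "\<Union>\<B> = B" "\<forall>X\<in>\<B>. X \<noteq> {} \<and> is_connected X"
        "\<forall>X\<in>\<B>. \<forall>Y\<in>\<B>. X \<noteq> Y \<longrightarrow> anticomplete X Y"
      using less.hyps[of A] less.hyps[of B] by auto
    have AcB: "anticomplete X Y" "anticomplete Y X" if "X \<in> \<A>" "Y \<in> \<B>" for X Y
    proof -
      show "anticomplete X Y" 
        using that A(1) B(1) by (intro anticomplete_subset[OF AB(2)]) auto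
      then show "anticomplete Y X" by (rule anticomplete_sym)
    qed
    show ?thesis
    proof (intro exI[of _ "\<A> \<union> \<B>"] conjI)
      show "\<Union>(\<A> \<union> \<B>) = Z" using A(1) B(1) AB(1) by simp
      show "\<forall>X\<in>\<A> \<union> \<B>. X \<noteq> {} \<and> is_connected X" using A(2) B(2) by blast
      show "\<forall>X\<in>\<A> \<union> \<B>. \<forall>Y\<in>\<A> \<union> \<B>. X \<noteq> Y \<longrightarrow> anticomplete X Y"
        using A(3) B(3) AcB by (metis UnE)
    qed
  qed
qed

text \<open>
  This is Gallai's theorem that a \<open>k\<close>-vertex-critical graph with connected complement has at least
  \<open>2 k - 1\<close> vertices, stated for the complement.
\<close>

theorem gallai:
  assumes "finite V" "is_connected V" "is_critical V"
  shows "2 * theta V \<le> card V + 1"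
  using assms
proof (induction "card V" arbitrary: V rule: less_induct)
  case (less V)
  note fin = less.prems(1) and conn = less.prems(2)
  have finsub: "finite X" if "X \<subseteq> V" for X using that fin finite_subset by blast
  have crit: "theta (V - B) < theta V" if B: "B \<subseteq> V" "B \<noteq> {}" for B
  proof -
    obtain b where "b \<in> B" "b \<in> V" using B by blast
    then have "theta (V - B) \<le> theta (V - {b})" using fin by (intro theta_mono) auto
    also have "\<dots> < theta V" using less.prems(3) \<open>b \<in> V\<close> by (simp add: is_critical_def)
    finally show ?thesis .
  qed
  show ?case
  proof (rule ccontr)
    assume "\<not> ?thesis"
    then have big: "card V + 2 \<le> 2 * theta V" by simp
    then have "V \<noteq> {}" by auto
    then obtain v where v: "v \<in> V" by blast
    \<comment> \<open>Singletons qualify, because one clique restores a deleted vertex.\<close>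
    define P where "P = (\<lambda>B. B \<subseteq> V \<and> B \<noteq> {} \<and> theta V \<le> theta (V - B) + 1)"
    have "P {v}" using v theta_Diff_clique[of V "{v}"] fin by (simp add: P_def)
    moreover have "\<forall>B. P B \<longrightarrow> card B < Suc (card V)"
      using fin by (auto simp: P_def less_Suc_eq_le card_mono)
    ultimately obtain B where B: "P B" and Bmax: "\<And>B'. P B' \<Longrightarrow> card B' \<le> card B"
      using ex_has_greatest_nat[of P "{v}" card "Suc (card V)"] by auto
    have BV: "B \<subseteq> V" "B \<noteq> {}" and finB: "finite B" using B finsub by (auto simp: P_def)
    have thB: "theta V = theta (V - B) + 1"
      using B crit[OF BV] by (auto simp: P_def)
    obtain \<X> where UX: "\<Union>\<X> = V - B" and Xconn: "\<forall>X\<in>\<X>. X \<noteq> {} \<and> is_connected X"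
      and Xac: "\<forall>X\<in>\<X>. \<forall>Y\<in>\<X>. X \<noteq> Y \<longrightarrow> anticomplete X Y"
      using components_exist[of "V - B"] fin by auto
    have XV: "X \<subseteq> V - B" if "X \<in> \<X>" for X using that UX by blast
    have finX: "finite X" if "X \<in> \<X>" for X using XV[OF that] fin finite_subset by blast
    have fin\<X>: "finite \<X>" using UX fin by (metis finite_Diff finite_UnionD)
    have sum_theta: "theta (\<Union>\<Y>) = (\<Sum>X\<in>\<Y>. theta X)" if "\<Y> \<subseteq> \<X>" for \<Y>
      using that Xac finX fin\<X> by (intro theta_Union_anticomplete) (auto intro: finite_subset)
    \<comment> \<open>A vertex whose removal from its component does not lower the cover number could be added to B.\<close>
    have Xcrit: "theta (X - {x}) < theta X" if X: "X \<in> \<X>" and x: "x \<in> X" for X x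
    proof (rule ccontr)
      assume a: "\<not> ?thesis"
      let ?R = "\<Union>(\<X> - {X})"
      have R: "anticomplete X ?R" using X Xac unfolding anticomplete_def by blast
      have finR: "finite ?R" using UX fin by (intro finsub) blast
      have VB: "V - B = X \<union> ?R" using UX X by blast
      have VBx: "V - insert x B = (X - {x}) \<union> ?R"
      proof -
        have "x \<notin> ?R" using R x unfolding anticomplete_def by blast
        then have "(X \<union> ?R) - {x} = (X - {x}) \<union> ?R" by blast
        moreover have "V - insert x B = (V - B) - {x}" by blast
        ultimately show ?thesis using VB by metis
      qed
      have "theta (V - insert x B) = theta (X - {x}) + theta ?R"
        unfolding VBx using finX[OF X]
        by (intro theta_anticomplete finR anticomplete_subset[OF R]) auto
      moreover have "theta (V - B) = theta X + theta ?R"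
        unfolding VB using finX[OF X] finR R by (intro theta_anticomplete)
      ultimately have "P (insert x B)" using a thB BV XV[OF X] x by (auto simp: P_def)
      then have "card (insert x B) \<le> card B" by (rule Bmax)
      then show False using XV[OF X] x finB by auto
    qed
    have "2 * theta X \<le> card X + 1" if X: "X \<in> \<X>" for X
    proof (rule less.hyps[of X])
      show "card X < card V" using XV[OF X] BV fin by (intro psubset_card_mono) auto
      show "is_critical X" using Xcrit[OF X] by (simp add: is_critical_def)
      show "finite X" "is_connected X" using X finX Xconn by blast+
    qed
    then have "2 * theta (V - B) \<le> (\<Sum>X\<in>\<X>. card X + 1)"
      using sum_theta[of \<X>] UX by (simp add: sum_distrib_left sum_mono)
    also have "\<dots> = card (V - B) + card \<X>"
    proof -
      have "card (\<Union>\<X>) = (\<Sum>X\<in>\<X>. card X)"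
        using finX Xac by (intro card_Union_disjoint) (auto simp: pairwise_def disjnt_def anticomplete_def)
      then show ?thesis using UX by (simp add: sum.distrib del: add_Suc_right One_nat_def)
    qed
    finally have "card B \<le> card \<X>"
      using thB big BV fin finB by (simp add: card_Diff_subset) (use card_mono[OF fin BV(1)] in linarith)

    define \<Gamma> where "\<Gamma> = (\<lambda>b. {X \<in> \<X>. \<exists>x\<in>X. b \<sim> x})"
    have "finite (\<Gamma> b)" for b using fin\<X> by (simp add: \<Gamma>_def)
    then obtain J f where J: "J \<subseteq> B" "J = {} \<or> card (\<Union>(\<Gamma> ` J)) < card J"
      and f: "inj_on f (B - J)" "\<And>b. b \<in> B - J \<Longrightarrow> f b \<in> \<Gamma> b - \<Union>(\<Gamma> ` J)"
      using hall_deficient[of B \<Gamma>] finB by metis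
    define T where "T = \<Union>(\<Gamma> ` J)"
    have T: "T \<subseteq> \<X>" by (auto simp: T_def \<Gamma>_def)
    have JT: "\<not> b \<sim> x" if "b \<in> J" "x \<in> X" "X \<in> \<X> - T" for b x X
      using that by (auto simp: T_def \<Gamma>_def)
    have TT: "anticomplete (\<Union>T) (\<Union>(\<X> - T))"
    proof (rule anticomplete_Union)
      fix X Y assume "X \<in> T" "Y \<in> \<X> - T"
      then show "anticomplete X Y" using Xac T by (metis Diff_iff subsetD)
    qed
    have J_ac: "anticomplete (J \<union> \<Union>T) (\<Union>(\<X> - T))"
    proof (rule anticomplete_Un_left[OF _ TT])
      have "J \<inter> \<Union>(\<X> - T) = {}" using J(1) UX by blast
      then show "anticomplete J (\<Union>(\<X> - T))" using JT by (auto simp: anticomplete_def)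
    qed
    have VJ: "V - (B - J) = (J \<union> \<Union>T) \<union> \<Union>(\<X> - T)" using UX T J(1) BV(1) by blast
    \<comment> \<open>If J were all of B, counting would give a component without neighbours in B, and V would
       not be connected.\<close>
    have "B - J \<noteq> {}"
    proof
      assume "B - J = {}"
      then have "J = B" using J(1) by blast
      then have "card T < card \<X>" using J(2) BV(2) \<open>card B \<le> card \<X>\<close> by (simp add: T_def)
      then obtain X where X: "X \<in> \<X>" "X \<notin> T" using T by (metis less_irrefl subsetI subset_antisym)
      have "V = (J \<union> \<Union>T) \<union> \<Union>(\<X> - T)" using VJ \<open>B - J = {}\<close> by simp
      then have "J \<union> \<Union>T = {} \<or> \<Union>(\<X> - T) = {}" 
        using conn J_ac unfolding is_connected_def by metis
      then show False using X Xconn BV(2) \<open>J = B\<close> by auto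
    qed
    then have smaller: "theta (V - (B - J)) < theta V" using BV by (intro crit) auto
    have split: "theta (V - (B - J)) = theta (J \<union> \<Union>T) + theta (\<Union>(\<X> - T))"
      unfolding VJ by (intro theta_anticomplete[OF _ _ J_ac] finsub) (use UX T J(1) BV(1) in blast)+

    \<comment> \<open>A component absorbs the vertex b matched to it: cover b together with a neighbour x in the
       component by an edge, and use that the component without x needs one clique less.\<close>
    define g where "g = (\<lambda>X. X \<union> {b \<in> B - J. f b = X})"
    have g: "finite (g X) \<and> theta (g X) \<le> theta X" if X: "X \<in> \<X> - T" for X
    proof (cases "\<exists>b\<in>B - J. f b = X")
      case True
      then obtain b where b: "b \<in> B - J" "f b = X" by blast
      then obtain x where x: "x \<in> X" "b \<sim> x" using f(2)[of b] by (auto simp: \<Gamma>_def)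
      have gX: "g X = (X - {x}) \<union> {b, x}"
        using b x f(1) by (auto simp: g_def inj_on_def)
      have "theta (g X) \<le> theta (X - {x}) + theta {b, x}"
        unfolding gX using X finX by (intro theta_Un) auto
      also have "theta {b, x} \<le> 1" using x by (intro theta_clique) simp
      finally have "theta (g X) \<le> theta X" using Xcrit[of X x] X x(1) by simp
      then show ?thesis using gX X finX by simp
    next
      case False
      then have "g X = X" by (auto simp: g_def)
      then show ?thesis using X finX by simp
    qed
    have BJ: "B - J \<subseteq> \<Union>(g ` (\<X> - T))"
    proof
      fix b assume b: "b \<in> B - J"
      then have "f b \<in> \<X> - T" using f(2)[OF b] by (auto simp: T_def \<Gamma>_def)
      then show "b \<in> \<Union>(g ` (\<X> - T))" using b by (auto simp: g_def)
    qed
    have "\<Union>(\<X> - T) \<subseteq> \<Union>(g ` (\<X> - T))" by (auto simp: g_def)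
    then have "V - (B - J) \<subseteq> (J \<union> \<Union>T) \<union> \<Union>(g ` (\<X> - T))"
      unfolding VJ by (rule Un_mono[OF subset_refl])
    then have V: "V \<subseteq> (J \<union> \<Union>T) \<union> \<Union>(g ` (\<X> - T))"
      using BJ by (meson DiffI UnI2 subset_iff)
    have "finite (J \<union> \<Union>T)" using J(1) BV(1) UX T by (intro finsub) blast
    moreover have "finite (\<Union>(g ` (\<X> - T)))" using g fin\<X> by auto
    ultimately have "theta V \<le> theta (J \<union> \<Union>T) + theta (\<Union>(g ` (\<X> - T)))"
      using order_trans[OF theta_mono[OF _ V] theta_Un] by simp
    also have "theta (\<Union>(g ` (\<X> - T))) \<le> (\<Sum>X\<in>\<X> - T. theta (g X))"
      using fin\<X> g by (intro theta_UN_le) auto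
    also have "\<dots> \<le> (\<Sum>X\<in>\<X> - T. theta X)" using g by (intro sum_mono) auto
    also have "\<dots> = theta (\<Union>(\<X> - T))" using sum_theta[of "\<X> - T"] by simp
    finally have "theta V \<le> theta (J \<union> \<Union>T) + theta (\<Union>(\<X> - T))" by simp
    then show False using smaller split by linarith
  qed
qed

end

section \<open>Nine vertices without a stable set of size four\<close>

context adjacency
begin

text \<open>
  The bound \<open>R(3,3) \<le> 6\<close>: a vertex has three neighbours, two of them adjacent, or three
  non-neighbours, which then form a clique.
\<close>

lemma triangle_if_alpha_le_2:
  assumes "finite X" "6 \<le> card X" "alpha X \<le> 2"
  shows "\<exists>T\<subseteq>X. card T = 3 \<and> is_clique T"
proof -
  have ind: "card S \<le> 2" if "S \<subseteq> X" "is_indep S" for S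
    using that assms alpha_le_iff by blast
  obtain v where v: "v \<in> X" using assms(2) by fastforce
  define N M where "N = {u \<in> X. v \<sim> u}" and "M = {u \<in> X. u \<noteq> v \<and> \<not> v \<sim> u}"
  have X: "X = insert v (N \<union> M)" using v adj_irrefl by (auto simp: N_def M_def)
  have "finite (N \<union> M)" using assms(1) by (simp add: N_def M_def)
  then have "card X \<le> Suc (card (N \<union> M))" unfolding X by (simp add: card_insert_if)
  also have "\<dots> \<le> Suc (card N + card M)" using card_Un_le by auto
  finally have "6 \<le> Suc (card N + card M)" using assms(2) by linarith
  then consider "3 \<le> card N" | "3 \<le> card M" by linarith
  then show ?thesis
  proof cases
    case 1
    then obtain S where S: "S \<subseteq> N" "card S = 3" by (metis obtain_subset_with_card_n)
    then have "\<not> is_indep S" using ind[of S] by (auto simp: N_def)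
    then obtain a b where ab: "a \<in> S" "b \<in> S" "a \<sim> b" by (auto simp: is_indep_def)
    have va: "v \<sim> a" "v \<sim> b" "a \<in> X" "b \<in> X" using ab S(1) by (auto simp: N_def)
    then have "is_clique {v, a, b}" using ab(3) by (intro is_clique_insert) auto
    moreover have "card {v, a, b} = 3" using va ab(3) adj_irrefl by (auto simp: card_insert_if)
    ultimately show ?thesis using va v by (intro exI[of _ "{v, a, b}"]) auto
  next
    case 2
    then obtain S where S: "S \<subseteq> M" "card S = 3" by (metis obtain_subset_with_card_n)
    have "is_clique S"
      unfolding is_clique_def
    proof (intro ballI impI, rule ccontr)
      fix a b assume ab: "a \<in> S" "b \<in> S" "a \<noteq> b" "\<not> a \<sim> b"
      then have m: "a \<in> M" "b \<in> M" using S(1) by auto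
      then have "is_indep {v, a, b}" using ab by (intro is_indep_insert) (auto simp: M_def)
      moreover have "card {v, a, b} = 3" using m ab(3) by (auto simp: M_def card_insert_if)
      ultimately show False using ind[of "{v, a, b}"] m v by (auto simp: M_def)
    qed
    then show ?thesis using S by (intro exI[of _ S]) (auto simp: M_def)
  qed
qed

lemma edge_if_card_gt_alpha:
  assumes "finite X" "alpha X < card X"
  shows "\<exists>a\<in>X. \<exists>b\<in>X. a \<sim> b"
  using assms card_le_alpha[of X X] unfolding is_indep_def by fastforce

lemma is_clique_triple: "a \<sim> b \<Longrightarrow> a \<sim> c \<Longrightarrow> b \<sim> c \<Longrightarrow> is_clique {a, b, c}"
  by (rule is_clique_insert) auto

lemma card_Diff_pair: "a \<in> X \<Longrightarrow> b \<in> X \<Longrightarrow> a \<sim> b \<Longrightarrow> finite X \<Longrightarrow> card (X - {a, b}) = card X - 2"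
  using adj_irrefl by (subst card_Diff_subset) (auto simp: card_insert_if)

text \<open>
  In the complement: a triangle-free graph on at most four vertices contains no odd cycle and is
  bipartite.
\<close>

lemma theta_le_2:
  assumes "finite X" "card X \<le> 4" "alpha X \<le> 2"
  shows "theta X \<le> 2"
proof -
  have ind: "card S \<le> 2" if "S \<subseteq> X" "is_indep S" for S
    using that assms alpha_le_iff by blast
  consider "card X \<le> 2" | "card X = 3" | "card X = 4" using assms(2) by linarith
  then show ?thesis
  proof cases
    case 1
    then show ?thesis using theta_le_card[OF assms(1)] by linarith
  next
    case 2
    then have "alpha X < card X" using assms(3) by linarith
    then obtain a b where ab: "a \<in> X" "b \<in> X" "a \<sim> b"
      using edge_if_card_gt_alpha[OF assms(1)] by blast
    have "theta X \<le> theta (X - {a, b}) + 1"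
      using assms(1) ab by (intro theta_Diff_clique) auto
    also have "theta (X - {a, b}) \<le> 1"
      using theta_le_card[of "X - {a, b}"] card_Diff_pair[OF ab assms(1)] 2 assms(1) by simp
    finally show ?thesis by simp
  next
    case 3
    then have "card X = Suc 3" by simp
    then obtain a X' where X': "X = insert a X'" "a \<notin> X'" "card X' = 3"
      unfolding card_Suc_eq by blast
    then obtain b c d where "X' = {b, c, d}" "b \<noteq> c" "b \<noteq> d" "c \<noteq> d"
      unfolding card_3_iff by blast
    then have X: "X = {a, b, c, d}" and d: "distinct [a, b, c, d]" using X' by auto
    have tri: "u \<sim> v \<or> u \<sim> w \<or> v \<sim> w"
      if uvw: "distinct [u, v, w]" "u \<in> X" "v \<in> X" "w \<in> X" for u v w
    proof (rule ccontr)
      assume "\<not> ?thesis"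
      then have "is_indep {u, v, w}" by (intro is_indep_insert) auto
      then show False using ind[of "{u, v, w}"] uvw by simp
    qed
    have t: "a \<sim> b \<or> a \<sim> c \<or> b \<sim> c" "a \<sim> b \<or> a \<sim> d \<or> b \<sim> d"
      "a \<sim> c \<or> a \<sim> d \<or> c \<sim> d" "b \<sim> c \<or> b \<sim> d \<or> c \<sim> d"
      by (rule tri; use d X in simp)+
    have cov: "theta X \<le> 2" if KL: "is_clique K" "is_clique L" "X = K \<union> L" for K L
    proof -
      have "finite K" "finite L" using KL(3) assms(1) by auto
      then have "theta X \<le> theta K + theta L" unfolding KL(3) by (rule theta_Un)
      then show ?thesis using theta_clique[OF KL(1)] theta_clique[OF KL(2)] by linarith
    qed
    have "(a \<sim> b \<and> c \<sim> d) \<or> (a \<sim> c \<and> b \<sim> d) \<or> (a \<sim> d \<and> b \<sim> c)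
      \<or> (a \<sim> b \<and> a \<sim> c \<and> b \<sim> c) \<or> (a \<sim> b \<and> a \<sim> d \<and> b \<sim> d)
      \<or> (a \<sim> c \<and> a \<sim> d \<and> c \<sim> d) \<or> (b \<sim> c \<and> b \<sim> d \<and> c \<sim> d)"
      using t by blast
    then show ?thesis
    proof (elim disjE)
      assume "a \<sim> b \<and> c \<sim> d" then show ?thesis using X by (intro cov[of "{a, b}" "{c, d}"]) auto
    next
      assume "a \<sim> c \<and> b \<sim> d" then show ?thesis using X by (intro cov[of "{a, c}" "{b, d}"]) auto
    next
      assume "a \<sim> d \<and> b \<sim> c" then show ?thesis using X by (intro cov[of "{a, d}" "{b, c}"]) auto
    next
      assume "a \<sim> b \<and> a \<sim> c \<and> b \<sim> c"
      then show ?thesis using X by (intro cov[of "{a, b, c}" "{d}"] is_clique_triple) auto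
    next
      assume "a \<sim> b \<and> a \<sim> d \<and> b \<sim> d"
      then show ?thesis using X by (intro cov[of "{a, b, d}" "{c}"] is_clique_triple) auto
    next
      assume "a \<sim> c \<and> a \<sim> d \<and> c \<sim> d"
      then show ?thesis using X by (intro cov[of "{a, c, d}" "{b}"] is_clique_triple) auto
    next
      assume "b \<sim> c \<and> b \<sim> d \<and> c \<sim> d"
      then show ?thesis using X by (intro cov[of "{b, c, d}" "{a}"] is_clique_triple) auto
    qed
  qed
qed

text \<open>
  Removing a triangle (or an edge, or nothing, for smaller sets) leaves at most four vertices.
\<close>

lemma theta_le_3:
  assumes fin: "finite X" and "card X \<le> 7" "alpha X \<le> 2"
  shows "theta X \<le> 3"
proof -
  have step: "theta X \<le> 3" if K: "is_clique K" "K \<subseteq> X" "card X \<le> card K + 4" for K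
  proof -
    have "card (X - K) \<le> 4" using K(2,3) fin by (subst card_Diff_subset) (auto intro: finite_subset)
    moreover have "alpha (X - K) \<le> 2" using alpha_mono[of X "X - K"] fin assms(3) by simp
    ultimately have "theta (X - K) \<le> 2" using fin by (intro theta_le_2) auto
    then show ?thesis using theta_Diff_clique[OF fin K(1)] by linarith
  qed
  consider "card X \<le> 4" | "card X = 5" | "6 \<le> card X" by linarith
  then show ?thesis
  proof cases
    case 1
    then show ?thesis using step[of "{}"] by simp
  next
    case 2
    then have "alpha X < card X" using assms(3) by linarith
    then obtain a b where ab: "a \<in> X" "b \<in> X" "a \<sim> b"
      using edge_if_card_gt_alpha[OF fin] by blast
    then have "a \<noteq> b" using adj_irrefl by blast
    then show ?thesis using step[of "{a, b}"] ab 2 by simp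
  next
    case 3
    then obtain T where "T \<subseteq> X" "card T = 3" "is_clique T"
      using triangle_if_alpha_le_2[OF fin _ assms(3)] by blast
    then show ?thesis using step[of T] assms(2) by simp
  qed
qed

text \<open>
  Adding a vertex \<open>x\<close> raises the degree sum by twice the degree of \<open>x\<close>.
\<close>

lemma even_sum_degrees: "finite X \<Longrightarrow> even (\<Sum>v\<in>X. card {u \<in> X. v \<sim> u})"
proof (induction rule: finite_induct)
  case (insert x X)
  let ?N = "{u \<in> X. x \<sim> u}"
  have "card {u \<in> insert x X. v \<sim> u} = card {u \<in> X. v \<sim> u} + (if v \<in> ?N then 1 else 0)" if "v \<in> X" for v
  proof (cases "v \<sim> x")
    case True
    then have "{u \<in> insert x X. v \<sim> u} = insert x {u \<in> X. v \<sim> u}" by auto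
    then show ?thesis using True insert.hyps adj_sym[OF True] that by simp
  next
    case False
    then have "{u \<in> insert x X. v \<sim> u} = {u \<in> X. v \<sim> u}" "v \<notin> ?N" using adj_sym by auto
    then show ?thesis by simp
  qed
  then have "(\<Sum>v\<in>X. card {u \<in> insert x X. v \<sim> u}) = (\<Sum>v\<in>X. card {u \<in> X. v \<sim> u} + (if v \<in> ?N then 1 else 0))"
    by (intro sum.cong) auto
  also have "\<dots> = (\<Sum>v\<in>X. card {u \<in> X. v \<sim> u}) + card ?N"
    using insert.hyps(1) by (simp add: sum.distrib sum.If_cases Int_def)
  finally have "(\<Sum>v\<in>X. card {u \<in> insert x X. v \<sim> u}) = (\<Sum>v\<in>X. card {u \<in> X. v \<sim> u}) + card ?N" .
  moreover have "{u \<in> insert x X. x \<sim> u} = ?N" using adj_irrefl by auto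
  ultimately show ?case using insert by simp
qed simp

text \<open>
  The bound \<open>R(3,4) \<le> 9\<close>. In a triangle-free graph the neighbours of a vertex are stable, so there are
  at most three; and there are at least three, since the non-neighbours contain no stable set of
  size three and so number at most five. But no graph on nine vertices is 3-regular.
\<close>

lemma nine_triangle:
  assumes fin: "finite V" and card: "card V = 9" and alpha: "alpha V \<le> 3"
  shows "\<exists>T\<subseteq>V. card T = 3 \<and> is_clique T"
proof (rule ccontr)
  assume "\<not> ?thesis"
  then have no: "\<not> is_clique T" if "T \<subseteq> V" "card T = 3" for T using that by blast
  have ind: "card S \<le> 3" if "S \<subseteq> V" "is_indep S" for S
    using that fin alpha alpha_le_iff by blast
  have deg: "card {u \<in> V. v \<sim> u} = 3" if v: "v \<in> V" for v
  proof (rule antisym)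
    let ?N = "{u \<in> V. v \<sim> u}"
    let ?M = "V - insert v ?N"
    have "is_indep ?N"
      unfolding is_indep_def
    proof (intro ballI notI)
      fix a b assume ab: "a \<in> ?N" "b \<in> ?N" "a \<sim> b"
      then have "is_clique {v, a, b}" by (intro is_clique_insert) auto
      moreover have "card {v, a, b} = 3" using ab adj_irrefl by (auto simp: card_insert_if)
      ultimately show False using no[of "{v, a, b}"] ab v by auto
    qed
    then show "card ?N \<le> 3" by (intro ind) auto
    have "alpha ?M \<le> 2"
    proof (subst alpha_le_iff, use fin in simp, intro allI impI)
      fix S assume S: "S \<subseteq> ?M" "is_indep S"
      then have "is_indep (insert v S)" by (intro is_indep_insert) auto
      then have "card (insert v S) \<le> 3" using S v by (intro ind) auto
      moreover have "v \<notin> S" "finite S" using S fin by (auto intro: finite_subset)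
      ultimately show "card S \<le> 2" by simp
    qed
    have "card ?M < 6"
    proof (rule ccontr)
      assume "\<not> ?thesis"
      then obtain T where "T \<subseteq> ?M" "card T = 3" "is_clique T"
        using triangle_if_alpha_le_2[OF _ _ \<open>alpha ?M \<le> 2\<close>] fin by (auto simp: not_less)
      then show False using no[of T] by blast
    qed
    moreover have "card ?M = 9 - Suc (card ?N)"
      using v fin card adj_irrefl by (subst card_Diff_subset) auto
    ultimately show "3 \<le> card ?N" by linarith
  qed
  have "(\<Sum>v\<in>V. card {u \<in> V. v \<sim> u}) = 27" using deg card by simp
  then show False using even_sum_degrees[OF fin] by simp
qed

text \<open>
  The closed neighbourhood of \<open>w\<close> is a clique with at least two elements, and outside it all stable
  sets have at most two elements because they extend by \<open>w\<close>.
\<close>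

lemma simplicial_nine:
  assumes fin: "finite V" and card: "card V = 9" and alpha: "alpha V \<le> 3"
    and w: "w \<in> V" "is_clique {u \<in> V. w \<sim> u}" "\<exists>u\<in>V. w \<sim> u"
  shows "theta V \<le> 4"
proof -
  let ?K = "insert w {u \<in> V. w \<sim> u}"
  have K: "is_clique ?K" using w(2) by (intro is_clique_insert) auto
  have "alpha (V - ?K) \<le> 2"
  proof (subst alpha_le_iff, use fin in simp, intro allI impI)
    fix S assume S: "S \<subseteq> V - ?K" "is_indep S"
    then have "is_indep (insert w S)" by (intro is_indep_insert) auto
    moreover have "insert w S \<subseteq> V" using S(1) w(1) by blast
    ultimately have "card (insert w S) \<le> 3" using fin alpha alpha_le_iff by blast
    moreover have "w \<notin> S" "finite S" using S fin by (auto intro: finite_subset)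
    ultimately show "card S \<le> 2" by simp
  qed
  moreover have "card (V - ?K) \<le> 7"
  proof -
    obtain u where u: "u \<in> V" "w \<sim> u" using w(3) by blast
    then have "u \<noteq> w" using adj_irrefl by blast
    have "card (V - ?K) \<le> card (V - {w, u})" using fin u by (intro card_mono) auto
    also have "\<dots> = 7" using fin u w(1) card card_Diff_pair[of w V u] by simp
    finally show ?thesis .
  qed
  ultimately have "theta (V - ?K) \<le> 3" using fin by (intro theta_le_3) auto
  then show ?thesis using theta_Diff_clique[OF fin K] by linarith
qed

text \<open>
  A perfect matching between \<open>R\<close> and \<open>S\<close> covers the six vertices by three edges. Hall's condition can
  only fail at two vertices \<open>x\<close>, \<open>y\<close> of \<open>R\<close> with a common single neighbour \<open>s\<close> in \<open>S\<close>. Then \<open>x\<close> and \<open>y\<close> are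
  adjacent, as they and the other two vertices of \<open>S\<close> would otherwise be stable, and the triangle
  \<open>x y s\<close> leaves three vertices containing an edge.
\<close>

lemma six_vertices:
  assumes R: "finite R" "card R = 3" and S: "finite S" "card S = 3" and dis: "R \<inter> S = {}"
    and alpha: "alpha (R \<union> S) \<le> 3"
    and nbr: "\<And>x. x \<in> R \<Longrightarrow> \<exists>s\<in>S. x \<sim> s" "\<And>s. s \<in> S \<Longrightarrow> \<exists>x\<in>R. s \<sim> x" and "is_indep S"
  shows "theta (R \<union> S) \<le> 3"
proof -
  define N where "N = (\<lambda>x. {s \<in> S. x \<sim> s})"
  have finN: "finite (N x)" for x using S(1) by (simp add: N_def)
  show ?thesis
  proof (cases "\<forall>J\<subseteq>R. card J \<le> card (\<Union>(N ` J))")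
    case True
    then have "\<exists>f. inj_on f R \<and> (\<forall>x\<in>R. f x \<in> N x)"
      using R(1) finN by (intro hall) auto
    then obtain f where f: "inj_on f R" "\<forall>x\<in>R. f x \<in> N x" by blast
    have "f ` R \<subseteq> S" using f(2) by (auto simp: N_def)
    then have "f ` R = S" using card_image[OF f(1)] R S by (intro card_subset_eq) auto
    then have "R \<union> S = \<Union>((\<lambda>x. {x, f x}) ` R)" by auto
    also have "theta \<dots> \<le> (\<Sum>x\<in>R. theta {x, f x})" using R(1) by (intro theta_UN_le) auto
    also have "\<dots> \<le> (\<Sum>x\<in>R. 1)" using f(2) by (intro sum_mono theta_clique) (auto simp: N_def)
    finally show ?thesis using R by simp
  next
    case False
    then obtain J where J: "J \<subseteq> R" "card (\<Union>(N ` J)) < card J" by (metis not_less)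
    have finJ: "finite J" using J(1) R(1) finite_subset by blast
    have finNJ: "finite (\<Union>(N ` J))" using finJ finN by blast
    have "J \<noteq> R"
    proof
      assume "J = R"
      have "S \<subseteq> \<Union>(N ` R)"
      proof
        fix s assume s: "s \<in> S"
        then obtain x where "x \<in> R" "s \<sim> x" using nbr(2) by blast
        then show "s \<in> \<Union>(N ` R)" using s adj_sym[of s x] by (auto simp: N_def)
      qed
      then have "card S \<le> card (\<Union>(N ` J))" using finNJ \<open>J = R\<close> by (intro card_mono) auto
      then show False using J \<open>J = R\<close> R S by simp
    qed
    then have "card J < 3" using J(1) R psubset_card_mono[of R J] by auto
    have "J \<noteq> {}" using J(2) by auto
    then obtain x where x: "x \<in> J" by blast
    then have "x \<in> R" using J(1) by blast
    then obtain s where s: "s \<in> N x" "s \<in> S" using nbr(1)[of x] by (auto simp: N_def)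
    have "card {s} \<le> card (\<Union>(N ` J))" using s x finNJ by (intro card_mono) auto
    then have "card J = 2" "card (\<Union>(N ` J)) = 1" using J(2) \<open>card J < 3\<close> by simp_all
    obtain t where "\<Union>(N ` J) = {t}" using \<open>card (\<Union>(N ` J)) = 1\<close> by (rule card_1_singletonE)
    moreover have "s \<in> \<Union>(N ` J)" using s x by blast
    ultimately have NJ: "\<Union>(N ` J) = {s}" by simp
    have "card (J - {x}) = 1" using x \<open>card J = 2\<close> by simp
    then obtain y where "J - {x} = {y}" by (rule card_1_singletonE)
    then have y: "J = {x, y}" "x \<noteq> y" using x by blast+
    have sub: "N x = {s}" "N y = {s}"
    proof -
      have "y \<in> R" using y(1) J(1) by blast
      then have "N y \<noteq> {}" using nbr(1)[of y] by (auto simp: N_def)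
      moreover have "N x \<subseteq> {s}" "N y \<subseteq> {s}" using NJ y(1) by auto
      ultimately show "N x = {s}" "N y = {s}" using s(1) by auto
    qed
    have "card (S - {s}) = 2" using s S by simp
    then obtain p q where pq: "S - {s} = {p, q}" "p \<noteq> q" by (meson card_2_iff)
    have xyR: "x \<in> R" "y \<in> R" using y J(1) by auto
    have "p \<in> S" "q \<in> S" "p \<notin> {s}" "q \<notin> {s}" using pq(1) by blast+
    then have non: "\<not> x \<sim> p" "\<not> x \<sim> q" "\<not> y \<sim> p" "\<not> y \<sim> q"
      using sub unfolding N_def by fastforce+
    have "x \<sim> y"
    proof (rule ccontr)
      assume "\<not> x \<sim> y"
      moreover have "is_indep {p, q}" using pq(1) by (intro is_indep_subset[OF \<open>is_indep S\<close>]) blast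
      ultimately have "is_indep {x, y, p, q}" using non by (intro is_indep_insert) auto
      moreover have "{x, y, p, q} \<subseteq> R \<union> S" using xyR pq by blast
      moreover have "finite (R \<union> S)" using R(1) S(1) by simp
      ultimately have "card {x, y, p, q} \<le> 3" using alpha alpha_le_iff by blast
      moreover have "x \<notin> {p, q}" "y \<notin> {p, q}" using xyR pq dis by blast+
      ultimately show False using y(2) pq(2) by simp
    qed
    then have K: "is_clique {x, y, s}" using sub by (intro is_clique_insert) (auto simp: N_def)
    have "card (R - {x, y}) = 1" using y xyR R by (subst card_Diff_subset) auto
    then obtain z where z: "R - {x, y} = {z}" by (meson card_1_singletonE)
    obtain r where r: "r \<in> R" "p \<sim> r" using nbr(2)[of p] pq by blast
    then have "r = z" using non z adj_sym by blast
    then have "is_clique {p, z}" using r by simp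
    have "R \<union> S = {x, y, s} \<union> ({p, z} \<union> {q})" using z pq xyR s by blast
    then have "theta (R \<union> S) \<le> theta {x, y, s} + (theta {p, z} + theta {q})"
      using theta_Un[of "{x, y, s}" "{p, z} \<union> {q}"] theta_Un[of "{p, z}" "{q}"] by simp
    then show ?thesis
      using theta_clique[OF K] theta_clique[OF \<open>is_clique {p, z}\<close>] theta_clique[of "{q}"] by simp
  qed
qed

text \<open>
  Remove a triangle \<open>T\<close>. The other six vertices should be covered by three cliques, which works if they
  contain no stable set of size three, or if they split into such a set \<open>S\<close> and a set \<open>R\<close> such that
  each vertex has a neighbour on the other side. A vertex of \<open>R\<close> has a neighbour in \<open>S\<close> because stable
  sets have size at most three; a vertex of \<open>S\<close> without neighbours in \<open>R\<close> has all its neighbours in \<open>T\<close>,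
  and \<open>simplicial_nine\<close> applies.
\<close>

theorem theta_nine:
  assumes fin: "finite V" and card: "card V = 9" and alpha: "alpha V \<le> 3"
    and nbr: "\<And>v. v \<in> V \<Longrightarrow> \<exists>u\<in>V. v \<sim> u"
  shows "theta V \<le> 4"
proof -
  obtain T where T: "T \<subseteq> V" "card T = 3" "is_clique T" using nine_triangle[OF fin card alpha] by blast
  define U where "U = V - T"
  have finT: "finite T" using T(1) fin finite_subset by blast
  have U: "finite U" "card U = 6" "U \<subseteq> V" using fin card T finT by (auto simp: U_def card_Diff_subset)
  have step: "theta V \<le> 4" if "theta U \<le> 3"
    using theta_Diff_clique[OF fin T(3)] that by (simp add: U_def)
  show ?thesis
  proof (cases "alpha U \<le> 2")
    case True
    then show ?thesis using U by (intro step theta_le_3) auto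
  next
    case False
    then have "alpha U = 3" using alpha_mono[OF fin U(3)] alpha by linarith
    then obtain S where S: "S \<subseteq> U" "is_indep S" "card S = 3"
      using alpha_attained[OF U(1)] by metis
    define R where "R = U - S"
    have finS: "finite S" using S(1) U(1) finite_subset by blast
    have R: "finite R" "card R = 3" "R \<inter> S = {}" "R \<union> S = U"
      using S U finS by (auto simp: R_def card_Diff_subset)
    have hit: "\<exists>s\<in>S. x \<sim> s" if x: "x \<in> R" for x
    proof (rule ccontr)
      assume "\<not> ?thesis"
      then have "is_indep (insert x S)" using S(2) by (intro is_indep_insert) auto
      moreover have "insert x S \<subseteq> V" using x S(1) U(3) by (auto simp: R_def)
      ultimately have "card (insert x S) \<le> 3" using fin alpha alpha_le_iff by blast
      then show False using x S(3) finS by (auto simp: R_def)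
    qed
    show ?thesis
    proof (cases "\<forall>s\<in>S. \<exists>x\<in>R. s \<sim> x")
      case True
      have "theta (R \<union> S) \<le> 3"
      proof (rule six_vertices)
        show "alpha (R \<union> S) \<le> 3" using R(4) alpha_mono[OF fin U(3)] alpha by simp
      qed (use R S finS hit True in auto)
      then show ?thesis using R(4) step by simp
    next
      case False
      then obtain w where w: "w \<in> S" "\<forall>x\<in>R. \<not> w \<sim> x" by blast
      have "{u \<in> V. w \<sim> u} \<subseteq> T"
      proof
        fix u assume u: "u \<in> {u \<in> V. w \<sim> u}"
        then have "u \<notin> S" "u \<notin> R" using w S(2) by (auto simp: is_indep_def)
        then show "u \<in> T" using u R(4) by (auto simp: U_def)
      qed
      then have "is_clique {u \<in> V. w \<sim> u}" by (rule is_clique_subset[OF T(3)])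
      moreover have "w \<in> V" using w(1) S(1) U(3) by blast
      ultimately show ?thesis using nbr by (intro simplicial_nine[OF fin card alpha]) auto
    qed
  qed
qed

section \<open>The upper bound\<close>

text \<open>
  A minimal counterexample is critical and connected, so that \<open>2 \<theta> \<le> |V| + 1 \<le> 3 \<alpha> + 1\<close>; for \<open>\<alpha> \<ge> 5\<close> this
  suffices, and small values of \<open>\<alpha>\<close> are inspected one by one.
\<close>

theorem theta_le_8_5_alpha:
  assumes "finite V" and "\<And>X. X \<subseteq> V \<Longrightarrow> card X \<le> 3 * alpha X"
  shows "5 * theta V \<le> 8 * alpha V"
  using assms
proof (induction "card V" arbitrary: V rule: less_induct)
  case (less V)
  note fin = less.prems(1) and third = less.prems(2)
  have IH: "5 * theta X \<le> 8 * alpha X" if X: "X \<subset> V" for X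
  proof (rule less.hyps)
    show "card X < card V" using psubset_card_mono[OF fin X] .
    show "finite X" using X fin finite_subset by blast
    show "card Y \<le> 3 * alpha Y" if "Y \<subseteq> X" for Y using third[of Y] that X by auto
  qed
  consider "\<not> is_critical V" | "\<not> is_connected V" | "is_critical V" "is_connected V" by blast
  then show ?case
  proof cases
    case 1
    then obtain x where x: "x \<in> V" "theta V \<le> theta (V - {x})"
      by (auto simp: is_critical_def not_less)
    have "5 * theta (V - {x}) \<le> 8 * alpha (V - {x})" using x(1) by (intro IH) auto
    also have "alpha (V - {x}) \<le> alpha V" using fin by (intro alpha_mono) auto
    finally show ?thesis using x(2) by linarith
  next
    case 2
    then obtain A B where AB: "V = A \<union> B" "anticomplete A B" "A \<noteq> {}" "B \<noteq> {}"
      unfolding is_connected_def by blast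
    have "A \<inter> B = {}" using AB(2) by (simp add: anticomplete_def)
    then have "A \<subset> V" "B \<subset> V" using AB(1,3,4) by blast+
    then have "5 * theta A \<le> 8 * alpha A" "5 * theta B \<le> 8 * alpha B" by (auto intro: IH)
    moreover have "finite A" "finite B" using AB(1) fin by auto
    ultimately show ?thesis
      using theta_anticomplete[OF _ _ AB(2)] alpha_anticomplete[OF _ _ AB(2)] AB(1) by fastforce
  next
    case 3
    have n: "2 * theta V \<le> card V + 1" "card V \<le> 3 * alpha V"
      using gallai[OF fin 3(2,1)] third[of V] by auto
    consider "alpha V = 0" | "alpha V = 1" | "alpha V = 3" | "alpha V = 2" | "alpha V = 4" | "5 \<le> alpha V"
      by linarith
    then show ?thesis
    proof cases
      case 1
      then have "V = {}" using n(2) fin by simp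
      then show ?thesis by simp
    next
      case 2
      have "is_clique V"
        unfolding is_clique_def
      proof (intro ballI impI, rule ccontr)
        fix u v assume uv: "u \<in> V" "v \<in> V" "u \<noteq> v" "\<not> u \<sim> v"
        then have "card {u, v} \<le> alpha V" using fin by (intro card_le_alpha) auto
        then show False using 2 uv(3) by simp
      qed
      then show ?thesis using theta_clique[of V] 2 by simp
    next
      case three: 3
      have "theta V \<le> 4"
      proof (rule ccontr)
        assume "\<not> ?thesis"
        then have c: "card V = 9" using n three by linarith
        have "\<exists>u\<in>V. v \<sim> u" if v: "v \<in> V" for v
        proof (rule ccontr)
          assume "\<not> ?thesis"
          then have "anticomplete {v} (V - {v})" by (auto simp: anticomplete_def)
          moreover have "V = {v} \<union> (V - {v})" using v by blast
          ultimately have "V - {v} = {}" using 3(2) unfolding is_connected_def by blast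
          then have "V = {v}" using v by blast
          then have "card V = 1" by simp
          then show False using c by simp
        qed
        then show False using theta_nine[OF fin c] three \<open>\<not> theta V \<le> 4\<close> by simp
      qed
      then show ?thesis using three by simp
    next
      case 4
      then have "theta V \<le> 3" using n by linarith
      then show ?thesis using 4 by simp
    next
      case 5
      then have "theta V \<le> 6" using n by linarith
      then show ?thesis using 5 by simp
    next
      case 6
      then show ?thesis using n by linarith
    qed
  qed
qed

end

section \<open>From vertex sets to graphs\<close>

context adjacency
begin

text \<open>
  The adjacency relation is allowed to relate vertices outside \<open>G\<close>, so that one relation serves
  a graph and all its induced subgraphs.
\<close>

definition represents :: "'a pair_pre_digraph \<Rightarrow> bool" where
  "represents G \<longleftrightarrow> finite (pverts G) \<and>
     (\<forall>u\<in>pverts G. \<forall>v\<in>pverts G. (u, v) \<in> parcs G \<longleftrightarrow> u \<sim> v)"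

lemma stability_number_eq:
  assumes "represents G"
  shows "stability_number G = alpha (pverts G)"
proof -
  have "stable_set G S \<longleftrightarrow> S \<subseteq> pverts G \<and> is_indep S" for S
    using assms unfolding stable_set_def represents_def is_indep_def by (meson subsetD)
  then have "{card S |S. stable_set G S} = card ` {S. S \<subseteq> pverts G \<and> is_indep S}" by auto
  then show ?thesis by (simp add: stability_number_def alpha_def)
qed

lemma clique_cover_number_eq:
  assumes "represents G"
  shows "clique_cover_number G = theta (pverts G)"
proof -
  let ?V = "pverts G"
  have fin: "finite ?V" using assms by (simp add: represents_def)
  have clq: "clique G K \<longleftrightarrow> K \<subseteq> ?V \<and> is_clique K" for K
    using assms unfolding clique_def represents_def is_clique_def by (meson subsetD)
  let ?C = "{card \<K> |\<K>. clique_cover G \<K>}"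
  have sub: "\<K> \<subseteq> Pow ?V" if "clique_cover G \<K>" for \<K>
    using that by (auto simp: clique_cover_def)
  have "?C \<subseteq> {..card (Pow ?V)}"
    using sub fin by (auto intro!: card_mono)
  then have finC: "finite ?C" by (rule finite_subset) simp
  have lower: "theta ?V \<le> c" if "c \<in> ?C" for c
  proof -
    obtain \<K> where K: "clique_cover G \<K>" "c = card \<K>" using \<open>c \<in> ?C\<close> by blast
    have "finite \<K>" using sub[OF K(1)] fin by (meson finite_Pow_iff finite_subset)
    then have "coverable ?V c"
      using K clq unfolding coverable_def clique_cover_def by (intro exI[of _ \<K>]) auto
    then show ?thesis by (rule theta_le)
  qed
  obtain \<K> where K: "finite \<K>" "card \<K> \<le> theta ?V" "\<forall>K\<in>\<K>. is_clique K" "?V \<subseteq> \<Union>\<K>"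
    using coverable_theta[OF fin] unfolding coverable_def by blast
  let ?K = "(\<lambda>K. K \<inter> ?V) ` \<K>"
  have "clique_cover G ?K"
    unfolding clique_cover_def clq using K(3,4) by (auto intro: is_clique_subset)
  then have mem: "card ?K \<in> ?C" by blast
  have "Min ?C \<le> card ?K" using finC mem by (rule Min_le)
  also have "\<dots> \<le> theta ?V" using card_image_le[OF K(1)] K(2) by (rule le_trans)
  finally have "Min ?C \<le> theta ?V" .
  moreover have "theta ?V \<le> Min ?C" using finC mem lower by (intro Min.boundedI) auto
  ultimately show ?thesis by (simp add: clique_cover_number_def)
qed

lemma third_stable_class_iff:
  assumes G: "pair_graph G" and rep: "represents G"
  shows "G \<in> third_stable_class \<longleftrightarrow> (\<forall>X\<subseteq>pverts G. card X \<le> 3 * alpha X)"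
proof
  interpret pair_graph G by (rule G)
  assume third: "G \<in> third_stable_class"
  show "\<forall>X\<subseteq>pverts G. card X \<le> 3 * alpha X"
  proof (intro allI impI)
    fix X assume X: "X \<subseteq> pverts G"
    define H where "H = \<lparr>pverts = X, parcs = {e \<in> parcs G. fst e \<in> X \<and> snd e \<in> X}\<rparr>"
    have "wf_digraph (with_proj H)"
      by unfold_locales (auto simp: H_def)
    moreover have "wf_digraph (with_proj G)" by unfold_locales
    ultimately have "induced_subgraph (with_proj H) (with_proj G)"
      using X by (auto simp: induced_subgraph_def subgraph_def compatible_def H_def)
    then have "real (card (pverts H)) / 3 \<le> real (stability_number H)"
      using third by (simp add: third_stable_class_def)
    moreover have "represents H"
      using rep X unfolding represents_def H_def by (auto intro: finite_subset)
    ultimately have "real (card X) \<le> 3 * real (alpha X)"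
      using stability_number_eq[of H] by (simp add: H_def)
    then show "card X \<le> 3 * alpha X" by linarith
  qed
next
  assume third: "\<forall>X\<subseteq>pverts G. card X \<le> 3 * alpha X"
  have "real (card (pverts H)) / 3 \<le> real (stability_number H)"
    if H: "induced_subgraph (with_proj H) (with_proj G)" for H :: "'a pair_pre_digraph"
  proof -
    have HV: "pverts H \<subseteq> pverts G"
      and "parcs H = {e \<in> parcs G. fst e \<in> pverts H \<and> snd e \<in> pverts H}"
      using H by (auto simp: induced_subgraph_def subgraph_def)
    then have "represents H"
      using rep unfolding represents_def by (auto intro: finite_subset)
    then have "stability_number H = alpha (pverts H)" by (rule stability_number_eq)
    moreover have "card (pverts H) \<le> 3 * alpha (pverts H)" using third HV by blast
    ultimately show ?thesis by simp
  qed
  then show "G \<in> third_stable_class" using G by (simp add: third_stable_class_def)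
qed

lemma card_le_twice_theta:
  assumes "finite X" and tf: "\<And>a b c. a \<sim> b \<Longrightarrow> b \<sim> c \<Longrightarrow> \<not> a \<sim> c"
  shows "card X \<le> 2 * theta X"
proof -
  have c2: "finite K \<and> card K \<le> 2" if K: "is_clique K" for K
  proof (rule ccontr)
    assume "\<not> ?thesis"
    then have "infinite K \<or> 3 \<le> card K" by linarith
    then obtain T where T: "T \<subseteq> K" "card T = 3"
      by (metis infinite_arbitrarily_large obtain_subset_with_card_n)
    then obtain a b c where "T = {a, b, c}" "a \<noteq> b" "b \<noteq> c" "a \<noteq> c" by (auto simp: card_3_iff)
    then have "a \<sim> b" "b \<sim> c" "a \<sim> c" using K T(1) by (auto simp: is_clique_def)
    then show False using tf by blast
  qed
  obtain \<K> where K: "finite \<K>" "card \<K> \<le> theta X" "\<forall>K\<in>\<K>. is_clique K" "X \<subseteq> \<Union>\<K>"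
    using coverable_theta[OF assms(1)] unfolding coverable_def by blast
  have "card X \<le> card (\<Union>\<K>)" using K c2 by (intro card_mono) auto
  also have "\<dots> \<le> (\<Sum>K\<in>\<K>. card K)" using card_UN_le[OF K(1), of "\<lambda>K. K"] by simp
  also have "\<dots> \<le> (\<Sum>K\<in>\<K>. 2)" using K(3) c2 by (intro sum_mono) auto
  finally show ?thesis using K(2) by simp
qed

lemma card_le_3_alpha_if_3_colourable:
  fixes c :: "'a \<Rightarrow> nat"
  assumes "finite X" and "\<And>v. c v < 3" and col: "\<And>u v. u \<sim> v \<Longrightarrow> c u \<noteq> c v"
  shows "card X \<le> 3 * alpha X"
proof -
  have indep: "is_indep {v \<in> X. c v = i}" for i
    unfolding is_indep_def using col by (metis (mono_tags, lifting) mem_Collect_eq)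
  have "X = (\<Union>i\<in>{..<3}. {v \<in> X. c v = i})" using assms(2) by auto
  then have "card X \<le> (\<Sum>i<3. card {v \<in> X. c v = i})"
    using card_UN_le[of "{..<3::nat}" "\<lambda>i. {v \<in> X. c v = i}"] by simp
  also have "\<dots> \<le> (\<Sum>i<3::nat. alpha X)"
    using assms(1) indep by (intro sum_mono card_le_alpha) auto
  finally show ?thesis by simp
qed

end

section \<open>Graphs attaining the bound\<close>

text \<open>
  The branching computation of the stability number: a stable set omits the first vertex of the list,
  or contains it and omits its neighbours.
\<close>

fun indep_bound :: "('a \<Rightarrow> 'a \<Rightarrow> bool) \<Rightarrow> 'a list \<Rightarrow> nat" where
  "indep_bound E [] = 0"
| "indep_bound E (x # xs) =
     max (indep_bound E xs) (Suc (indep_bound E (filter (\<lambda>y. \<not> E x y) xs)))"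

lemma (in adjacency) card_indep_le_indep_bound:
  "is_indep S \<Longrightarrow> S \<subseteq> set xs \<Longrightarrow> card S \<le> indep_bound adj xs"
proof (induction "length xs" arbitrary: xs S rule: less_induct)
  case less
  show ?case
  proof (cases xs)
    case (Cons x ys)
    show ?thesis
    proof (cases "x \<in> S")
      case True
      let ?zs = "filter (\<lambda>y. \<not> x \<sim> y) ys"
      have "S - {x} \<subseteq> set ?zs" using less.prems True Cons by (auto simp: is_indep_def)
      moreover have "is_indep (S - {x})" using less.prems(1) by (rule is_indep_subset) blast
      moreover have "length ?zs < length xs" using Cons by (simp add: le_imp_less_Suc)
      ultimately have "card (S - {x}) \<le> indep_bound adj ?zs" using less.hyps by blast
      moreover have "finite S" using less.prems(2) finite_subset by blast
      ultimately show ?thesis using True Cons by (simp add: card_Diff_singleton)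
    next
      case False
      then have "S \<subseteq> set ys" using less.prems(2) Cons by auto
      then have "card S \<le> indep_bound adj ys" using less Cons by simp
      then show ?thesis using Cons by simp
    qed
  qed (use less.prems in simp)
qed

text \<open>
  The distances 1, 5, 8 are the connection set of the cyclic graph on \<open>\<int>/13\<close> that shows \<open>R(3,5) > 13\<close>,
  unrolled to the integers. None of them is a sum of two others (or twice another), which excludes
  triangles, and none is divisible by 3, which makes the residue mod 3 a proper colouring.
\<close>

definition dist_adj :: "nat \<Rightarrow> nat \<Rightarrow> bool" where
  "dist_adj u v \<longleftrightarrow> u = v + 1 \<or> u = v + 5 \<or> u = v + 8 \<or> v = u + 1 \<or> v = u + 5 \<or> v = u + 8"

text \<open>
  Disjoint copies of the same graph, one on each interval \<open>{15 k..<15 k + 15}\<close>.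
\<close>

definition block_adj :: "nat \<Rightarrow> nat \<Rightarrow> bool" where
  "block_adj u v \<longleftrightarrow> u div 15 = v div 15 \<and> dist_adj u v"

text \<open>
  For \<open>j < 5\<close>, vertices that induce a subgraph of the fifteen-vertex graph with \<open>\<alpha> = j\<close> and with enough
  vertices to force \<open>\<theta> \<ge> \<lfloor>8 j / 5\<rfloor>\<close>. The entry for \<open>j = 2\<close> is a cycle of length five.
\<close>

definition leftover :: "nat \<Rightarrow> nat list" where
  "leftover j = [[], [0], [0, 1, 2, 3, 8], [0, 1, 2, 3, 4, 5, 8], [0..<11]] ! j"

definition extremal_verts :: "nat \<Rightarrow> nat set" where
  "extremal_verts x = {..<15 * (x div 5)} \<union> (+) (15 * (x div 5)) ` set (leftover (x mod 5))"

definition extremal_graph :: "nat \<Rightarrow> nat pair_pre_digraph" where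
  "extremal_graph x = \<lparr>pverts = extremal_verts x,
     parcs = {(u, v). u \<in> extremal_verts x \<and> v \<in> extremal_verts x \<and> block_adj u v}\<rparr>"

interpretation D: adjacency dist_adj
  by unfold_locales (auto simp: dist_adj_def)

interpretation B: adjacency block_adj
  by unfold_locales (auto simp: block_adj_def dist_adj_def)

lemma indep_bound_block: "indep_bound dist_adj [0..<15] \<le> 5"
  by code_simp

lemma alpha_translate:
  assumes "set xs \<subseteq> {..<15}"
  shows "B.alpha ((+) (15 * k) ` set xs) \<le> indep_bound dist_adj xs"
proof (subst B.alpha_le_iff, simp, intro allI impI)
  fix S assume S: "S \<subseteq> (+) (15 * k) ` set xs" "B.is_indep S"
  then obtain T where T: "T \<subseteq> set xs" "S = (+) (15 * k) ` T" by (meson subset_imageE)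
  have "D.is_indep T"
    unfolding D.is_indep_def
  proof (intro ballI notI)
    fix a b assume ab: "a \<in> T" "b \<in> T" "dist_adj a b"
    have "a < 15" "b < 15" using ab T(1) assms by auto
    then have "block_adj (15 * k + a) (15 * k + b)"
      using ab(3) by (auto simp: block_adj_def dist_adj_def)
    then show False using S(2) T(2) ab by (auto simp: B.is_indep_def)
  qed
  then have "card T \<le> indep_bound dist_adj xs" using T(1) by (rule D.card_indep_le_indep_bound)
  then show "card S \<le> indep_bound dist_adj xs" using T(2) by (simp add: card_image)
qed

text \<open>
  The last two inequalities turn the number of vertices into the lower bounds for \<open>\<alpha>\<close> and \<open>\<theta>\<close> that
  3-colourability and triangle-freeness give.
\<close>

lemma leftover_facts:
  assumes "j < 5"
  shows "set (leftover j) \<subseteq> {..<15}" "distinct (leftover j)"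
    "indep_bound dist_adj (leftover j) \<le> j" "j \<le> (length (leftover j) + 2) div 3"
    "8 * j div 5 \<le> (length (leftover j) + 1) div 2"
proof -
  consider "j = 0" | "j = 1" | "j = 2" | "j = 3" | "j = 4" using assms by linarith
  note j = this
  show "set (leftover j) \<subseteq> {..<15}" using j by cases (auto simp: leftover_def)
  show "distinct (leftover j)" using j by cases (simp_all add: leftover_def)
  have bound: "indep_bound dist_adj (leftover 0) \<le> 0" "indep_bound dist_adj (leftover 1) \<le> 1"
    "indep_bound dist_adj (leftover 2) \<le> 2" "indep_bound dist_adj (leftover 3) \<le> 3"
    "indep_bound dist_adj (leftover 4) \<le> 4"
    by code_simp+
  show "indep_bound dist_adj (leftover j) \<le> j" using j by cases (simp_all only: bound)
  show "j \<le> (length (leftover j) + 2) div 3" using j by cases (simp_all add: leftover_def)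
  show "8 * j div 5 \<le> (length (leftover j) + 1) div 2" using j by cases (simp_all add: leftover_def)
qed

lemma block_image: "{..<15 * Suc k} = {..<15 * k} \<union> (+) (15 * k) ` set [0..<15]"
proof -
  have "(+) (15 * k) ` set [0..<15] = {15 * k..<15 * k + 15}" by (simp add: add.commute)
  then show ?thesis using ivl_disj_un_one(2)[of "15 * k" "15 * k + 15"] by (simp add: add.commute)
qed

lemma blocks_anticomplete:
  assumes "set xs \<subseteq> {..<15}"
  shows "B.anticomplete {..<15 * k} ((+) (15 * k) ` set xs)"
proof -
  have "u div 15 \<noteq> v div 15" if u: "u < 15 * k" and v: "v \<in> (+) (15 * k) ` set xs" for u v
  proof -
    obtain r where "v = 15 * k + r" "r < 15" using v assms by auto
    then have "v div 15 = k" by simp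
    moreover have "u div 15 < k" using u by (simp add: less_mult_imp_div_less mult.commute)
    ultimately show ?thesis by simp
  qed
  then show ?thesis unfolding B.anticomplete_def block_adj_def by blast
qed

lemma block_triangle_free: "block_adj a b \<Longrightarrow> block_adj b c \<Longrightarrow> \<not> block_adj a c"
  unfolding block_adj_def dist_adj_def by (elim conjE disjE; simp)

lemma dist_adj_mod_3: "dist_adj u v \<Longrightarrow> u mod 3 \<noteq> v mod 3"
  unfolding dist_adj_def by (elim disjE; hypsubst; presburger)

lemma theta_blocks: "8 * k \<le> B.theta {..<15 * k}"
proof (induction k)
  case (Suc k)
  let ?L = "[0..<15] :: nat list"
  have "card ((+) (15 * k) ` set ?L) \<le> 2 * B.theta ((+) (15 * k) ` set ?L)"
    by (rule B.card_le_twice_theta[OF _ block_triangle_free]) simp_all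
  moreover have "card ((+) (15 * k) ` set ?L) = 15" by (simp add: card_image)
  ultimately have "8 \<le> B.theta ((+) (15 * k) ` set ?L)" by linarith
  with Suc have "8 * Suc k \<le> B.theta {..<15 * k} + B.theta ((+) (15 * k) ` set ?L)" by simp
  also have "\<dots> = B.theta {..<15 * Suc k}"
    unfolding block_image
    by (rule B.theta_anticomplete[OF _ _ blocks_anticomplete, symmetric]) auto
  finally show ?case .
qed simp

lemma alpha_blocks: "B.alpha {..<15 * k} \<le> 5 * k"
proof (induction k)
  case 0
  then show ?case by (subst B.alpha_le_iff) auto
next
  case (Suc k)
  let ?L = "[0..<15] :: nat list"
  have "B.alpha {..<15 * Suc k} \<le> B.alpha {..<15 * k} + B.alpha ((+) (15 * k) ` set ?L)"
    unfolding block_image by (intro B.alpha_Un) auto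
  also have "\<dots> \<le> 5 * k + 5"
    using Suc by (intro add_mono le_trans[OF alpha_translate indep_bound_block]) auto
  finally show ?case by simp
qed

lemma extremal_graph:
  shows "extremal_graph x \<in> third_stable_class"
    and "stability_number (extremal_graph x) = x"
    and "8 * x div 5 \<le> clique_cover_number (extremal_graph x)"
proof -
  let ?k = "x div 5" and ?L = "leftover (x mod 5)"
  let ?V = "extremal_verts x" and ?R = "(+) (15 * (x div 5)) ` set (leftover (x mod 5))"
  have x: "x = 5 * ?k + x mod 5" by simp
  have "x mod 5 < 5" by simp
  note L = leftover_facts[OF this]
  have cardR: "card ?R = length ?L" using L(2) by (simp add: card_image distinct_card)
  have ac: "B.anticomplete {..<15 * ?k} ?R" using L(1) by (rule blocks_anticomplete)
  have V: "?V = {..<15 * ?k} \<union> ?R" by (simp add: extremal_verts_def)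
  have finV: "finite ?V" by (simp add: V)
  have cardV: "card ?V = 15 * ?k + length ?L"
    unfolding V using ac cardR by (subst card_Un_disjoint) (auto simp: B.anticomplete_def)
  have verts: "pverts (extremal_graph x) = ?V" by (simp add: extremal_graph_def)
  have rep: "B.represents (extremal_graph x)"
    using finV by (simp add: B.represents_def extremal_graph_def)
  have graph: "pair_graph (extremal_graph x)"
  proof
    show "finite (parcs (extremal_graph x))"
      by (rule finite_subset[of _ "?V \<times> ?V"]) (use finV in \<open>auto simp: extremal_graph_def\<close>)
  qed (use finV B.adj_sym B.adj_irrefl in \<open>auto simp: extremal_graph_def symmetric_def sym_def\<close>)
  have third: "card X \<le> 3 * B.alpha X" if "finite X" for X
    using that
  proof (rule B.card_le_3_alpha_if_3_colourable[where c = "\<lambda>v. v mod 3"])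
    show "u mod 3 \<noteq> v mod 3" if "block_adj u v" for u v
      using that dist_adj_mod_3 by (simp add: block_adj_def)
  qed simp
  show "extremal_graph x \<in> third_stable_class"
    using B.third_stable_class_iff[OF graph rep] third finV verts finite_subset by metis
  have "B.alpha ?V \<le> B.alpha {..<15 * ?k} + B.alpha ?R" unfolding V by (intro B.alpha_Un) auto
  also have "\<dots> \<le> 5 * ?k + x mod 5"
    using alpha_blocks[of ?k] le_trans[OF alpha_translate[OF L(1)] L(3)] by (rule add_mono)
  finally have "B.alpha ?V \<le> x" using x by simp
  moreover have "x \<le> B.alpha ?V"
  proof -
    have "x mod 5 \<le> (length ?L + 2) div 3" by (rule L(4))
    moreover have "15 * ?k + length ?L \<le> 3 * B.alpha ?V" using third[OF finV] cardV by simp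
    ultimately show ?thesis using x by linarith
  qed
  ultimately show "stability_number (extremal_graph x) = x"
    using B.stability_number_eq[OF rep] verts by simp
  have "card ?R \<le> 2 * B.theta ?R"
    by (rule B.card_le_twice_theta[OF _ block_triangle_free]) simp_all
  then have "8 * (x mod 5) div 5 \<le> B.theta ?R" using L(5) cardR by linarith
  moreover have "B.theta ?V = B.theta {..<15 * ?k} + B.theta ?R"
    unfolding V by (intro B.theta_anticomplete ac) auto
  moreover have "8 * x div 5 = 8 * ?k + 8 * (x mod 5) div 5"
  proof -
    have "8 * x = 8 * (x mod 5) + 5 * (8 * ?k)" using x by linarith
    then show ?thesis by (metis div_mult_self2 add.commute zero_neq_numeral)
  qed
  ultimately show "8 * x div 5 \<le> clique_cover_number (extremal_graph x)"
    using theta_blocks[of ?k] B.clique_cover_number_eq[OF rep] verts by simp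
qed

lemma clique_cover_number_le:
  assumes "G \<in> third_stable_class"
  shows "5 * clique_cover_number G \<le> 8 * stability_number G"
proof -
  have G: "pair_graph G" using assms by (simp add: third_stable_class_def)
  interpret pair_graph G by (rule G)
  interpret adjacency "\<lambda>u v. (u, v) \<in> parcs G"
    by unfold_locales (auto intro: arcs_symmetric dest: no_loops')
  have rep: "represents G" by (simp add: represents_def)
  have "5 * theta (pverts G) \<le> 8 * alpha (pverts G)"
    using third_stable_class_iff[OF G rep] assms by (intro theta_le_8_5_alpha) auto
  then show ?thesis using stability_number_eq[OF rep] clique_cover_number_eq[OF rep] by simp
qed

lemma floor_8_5: "\<lfloor>(8 / 5) * real n\<rfloor> = int (8 * n div 5)"
proof -
  have "(8 / 5) * real n = real (8 * n) / real 5" by simp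
  then show ?thesis by (simp only: floor_divide_of_nat_eq)
qed

theorem theorem2p1:
  shows "(\<forall>G \<in> (third_stable_class :: 'a pair_pre_digraph set).
            int (clique_cover_number G) \<le> \<lfloor>(8 / 5) * real (stability_number G)\<rfloor>)
       \<and> (\<forall>x::nat. \<exists>G \<in> (third_stable_class :: nat pair_pre_digraph set).
            stability_number G = x \<and>
            int (clique_cover_number G) = \<lfloor>(8 / 5) * real (stability_number G)\<rfloor>)"
proof (intro conjI ballI allI)
  fix G :: "'a pair_pre_digraph" assume "G \<in> third_stable_class"
  then show "int (clique_cover_number G) \<le> \<lfloor>(8 / 5) * real (stability_number G)\<rfloor>"
    unfolding floor_8_5 using clique_cover_number_le[of G] by linarith
next
  fix x :: nat
  have "clique_cover_number (extremal_graph x) \<le> 8 * x div 5"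
    using clique_cover_number_le[OF extremal_graph(1)[of x]] extremal_graph(2)[of x] by simp
  then have "clique_cover_number (extremal_graph x) = 8 * x div 5"
    using extremal_graph(3)[of x] by simp
  then show "\<exists>G \<in> (third_stable_class :: nat pair_pre_digraph set).
      stability_number G = x \<and>
      int (clique_cover_number G) = \<lfloor>(8 / 5) * real (stability_number G)\<rfloor>"
    unfolding floor_8_5 using extremal_graph[of x] by (intro bexI[of _ "extremal_graph x"]) auto
qed

end
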